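(* Let $\theta=\frac12(\sqrt5-1)$ and let $(s_i)_{i\ge0}$ be given by $s_i=\lfloor (i+2)\theta\rfloor-\lfloor (i+1)\theta\rfloor$. Let $n\ge2$ be an integer and put $r=L_{2n}$, $a=F_{2n-1}-1$, $b=L_{2n}-1$. Then $s_{rk+a}=s_{rk+b}$ for all $0\le k\le F_{4n+1}-F_{2n+1}-2$, while for $k=F_{4n+1}-F_{2n+1}-1$ we have $s_{rk+a}=0$ and $s_{rk+b}=1$.
   Context: Fibonacci numbers: $F_0=0$, $F_1=1$, $F_n=F_{n-1}+F_{n-2}$. Lucas numbers: $L_0=2$, $L_1=1$, $L_n=L_{n-1}+L_{n-2}$. *)

theory Defs
  imports Complex_Main "HOL-Number_Theory.Fib"
begin

fun lucas :: "nat \<Rightarrow> nat" where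
  "lucas 0 = 2"
| "lucas (Suc 0) = 1"
| "lucas (Suc (Suc n)) = lucas (Suc n) + lucas n"

definition theta :: real where
  "theta = (sqrt 5 - 1) / 2"

definition s :: "nat \<Rightarrow> int" where
  "s i = \<lfloor>real (i + 2) * theta\<rfloor> - \<lfloor>real (i + 1) * theta\<rfloor>"

text \<open>The next three facts say that none of the natural-number differences
  \<open>fib (2 * n - 1) - 1\<close>, \<open>lucas (2 * n) - 1\<close> and \<open>fib (4 * n + 1) - fib (2 * n + 1) - 2\<close>
  is truncated when \<open>n \<ge> 2\<close>.\<close>

lemma fib_odd_ge_1: "n \<ge> 2 \<Longrightarrow> fib (2 * n - 1) \<ge> 1"
  using fib_neq_0_nat[of "2 * n - 1"] by linarith

lemma lucas_ge_1: "lucas n \<ge> 1"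
  by (induction n rule: lucas.induct) auto

lemma fib_diff_ge_2:
  assumes "n \<ge> 2"
  shows "fib (4 * n + 1) \<ge> fib (2 * n + 1) + 2"
proof -
  have "fib (2 * n + 1) \<le> fib (4 * n - 1)"
    using assms by (intro fib_mono) auto
  moreover have "fib 3 \<le> fib (4 * n)"
    using assms by (intro fib_mono) auto
  moreover have "fib 3 = 2"
    by (simp add: numeral_3_eq_3)
  moreover have "fib (4 * n + 1) = fib (4 * n) + fib (4 * n - 1)"
    using assms by (cases "4 * n") auto
  ultimately show ?thesis
    by linarith
qed

end

theory Submission
  imports Defs
begin

text \<open>
  Put \<open>f = F\<^bsub>2n\<^esub>\<close>, \<open>g = F\<^bsub>2n-1\<^esub>\<close>, \<open>m = k + 1\<close>. Then \<open>r k + b + 1 = m r\<close> and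
  \<open>r k + a + 1 = m r - F\<^bsub>2n+1\<^esub>\<close>, and \<open>F\<^bsub>2n+1\<^esub> \<theta>\<close> exceeds an integer by \<open>\<eta> = \<theta>\<^bsup>2n+1\<^esup>\<close>. Hence the two
  values of \<open>s\<close> can differ only if \<open>m r \<theta>\<close> or \<open>m r \<theta> + \<theta>\<close> exceeds an integer \<open>P\<close> by less than \<open>\<eta>\<close>.
  Multiplying such an inequality by the unit \<open>\<theta>\<^bsup>-2n\<^esup> = f + g + f \<theta>\<close> and writing \<open>P\<close> as
  \<open>m L\<^bsub>2n-1\<^esub> + q\<close> gives \<open>0 \<le> j \<surd>5 - q \<theta>\<^bsup>2n\<^esup> < \<theta>\<close> with \<open>j = m - q f\<close> in the first case, and
  \<open>0 \<le> j \<surd>5 - (q + 1 + \<theta>) \<theta>\<^bsup>2n\<^esup> < \<theta>\<close> with \<open>j = m - q f + g\<close> in the second. Both force \<open>j \<ge> 1\<close>, so \<open>q\<close>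
  is at least about \<open>L\<^bsub>2n+1\<^esub>\<close>, which bounds \<open>m\<close> from below; the second bound is the smaller one and
  is attained at \<open>m = F\<^bsub>4n+1\<^esub> - F\<^bsub>2n+1\<^esub>\<close>.
\<close>

lemma theta_square: "theta * theta = 1 - theta"
  by (simp add: theta_def field_simps)

lemma theta_bounds: "1 / 2 < theta" "theta < 2 / 3"
proof -
  have "2 < sqrt 5" "sqrt 5 < 7 / 3"
    by (rule real_less_rsqrt real_less_lsqrt; simp add: power2_eq_square)+
  then show "1 / 2 < theta" "theta < 2 / 3"
    by (auto simp: theta_def)
qed

lemma floor_diff_eq_iff:
  fixes x e :: real
  assumes "0 \<le> e" "e < 1"
  shows "\<lfloor>x - e\<rfloor> = \<lfloor>x\<rfloor> \<longleftrightarrow> e \<le> x - of_int \<lfloor>x\<rfloor>"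
  using assms by (auto simp: floor_eq_iff) linarith+

lemma lucas_Suc_eq_fib: "lucas (Suc n) = fib n + fib (Suc (Suc n))"
  by (induction n rule: fib.induct) auto

text \<open>Cassini's identity at one parity: the left side is
  \<open>F_{2k+1} F_{2k+3} - F_{2k+2}^2\<close>.\<close>

lemma fib_odd_even_norm:
  "int (fib (Suc (2 * k))) ^ 2 + int (fib (Suc (2 * k))) * int (fib (2 * k + 2)) - int (fib (2 * k + 2)) ^ 2 = 1"
  by (induction k) (auto simp: power2_eq_square algebra_simps)

text \<open>The norm condition makes \<open>g - f \<theta>\<close> a unit of \<open>\<int>[\<theta>]\<close>; it equals \<open>\<theta>\<^bsup>2n\<^esup>\<close> for the Fibonacci pair.\<close>

locale golden_pair =
  fixes f g :: int
  assumes f_pos: "f \<ge> 1" and g_pos: "g \<ge> 1"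
    and norm: "g\<^sup>2 + g * f - f\<^sup>2 = 1"
begin

definition T :: real where "T = g - f * theta"
text \<open>The conjugate of \<open>T\<close> under \<open>theta\<close> \<rightarrow>
  \<open>-1 - theta\<close>, so \<open>T * W\<close> is the norm form of the locale.\<close>

definition W :: real where "W = f + g + f * theta"

lemma T_W: "T * W = 1"
proof -
  have "T * W = g\<^sup>2 + g * f - (real_of_int f)\<^sup>2 * (theta + theta * theta)"
    by (simp add: T_def W_def algebra_simps power2_eq_square)
  also have "\<dots> = of_int (g\<^sup>2 + g * f - f\<^sup>2)"
    by (simp add: theta_square)
  finally show ?thesis by (simp add: norm)
qed

lemma W_ge: "W \<ge> 2 + theta"
proof -
  have "1 * theta \<le> f * theta"
    using f_pos theta_bounds by (intro mult_right_mono) auto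
  moreover have "real_of_int f \<ge> 1" "real_of_int g \<ge> 1"
    using f_pos g_pos by simp_all
  ultimately show ?thesis
    unfolding W_def by linarith
qed

lemma W_pos: "W > 0"
  using W_ge theta_bounds by linarith

lemma T_eq: "T = 1 / W"
  using T_W W_pos by (simp add: field_simps)

lemma T_pos: "T > 0"
  using W_pos by (simp add: T_eq)

lemma T_le: "T \<le> 1 / 2"
  using W_pos W_ge theta_bounds by (simp add: T_eq field_simps)

text \<open>Identifies \<open>T * theta\<close> as the excess of \<open>(f + g) * theta\<close> over
  the integer \<open>f\<close>.\<close>

lemma T_theta: "T * theta = (f + g) * theta - f"
proof -
  have "T * theta = g * theta - f * (theta * theta)"
    by (simp add: T_def algebra_simps)
  then show ?thesis
    by (simp add: theta_square algebra_simps)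
qed

lemma T_theta_bounds: "0 < T * theta" "T * theta < 1 - theta"
proof -
  show "0 < T * theta"
    using T_pos theta_bounds by simp
  have "T * theta \<le> 1 / 2 * theta"
    using T_le theta_bounds by (intro mult_right_mono) auto
  then show "T * theta < 1 - theta"
    using theta_bounds by linarith
qed

lemma mult_W_less_iff: "x * W < theta \<longleftrightarrow> x < T * theta"
  using W_pos by (simp add: T_eq field_simps)

lemma one_plus_theta_W: "(1 + theta) * W = 3 * f + g + T * theta"
proof -
  have "(1 + theta) * W = 2 * f + g + (f + g) * theta + f * (theta * theta + theta - 1)"
    by (simp add: W_def algebra_simps)
  also have "\<dots> = 3 * f + g + ((f + g) * theta - f)"
    by (simp add: theta_square)
  finally show ?thesis
    by (simp only: T_theta)
qed

lemma unit_bound: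
  fixes x :: real
  assumes "x * T > 1 + theta"
  shows "x > 3 * f + g + T * theta"
proof -
  have "(1 + theta) * W < x"
    using assms W_pos by (simp add: T_eq field_simps)
  then show ?thesis
    by (simp add: one_plus_theta_W)
qed

section \<open>Multiples of \<open>theta\<close> just above an integer\<close>

text \<open>For the Fibonacci pair, \<open>f + 2 * g\<close> and \<open>2 * f - g\<close> are
  \<open>L_{2n}\<close> and \<open>L_{2n-1}\<close>, and \<open>1 + 2 * theta\<close> is the root of
  5. The second identity is \<open>W = f * (1 + 2 * theta) + T\<close>.\<close>

lemma crossing_0_W:
  fixes m q :: int
  shows "(m * (f + 2 * g) * theta - (m * (2 * f - g) + q)) * W = m * (1 + 2 * theta) - q * W"
    and "m * (1 + 2 * theta) - q * W = (m - q * f) * (1 + 2 * theta) - q * T"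
proof -
  have "(m * (f + 2 * g) * theta - (m * (2 * f - g) + q)) * W
      = m * (g\<^sup>2 + g * f - (real_of_int f)\<^sup>2) * (1 + 2 * theta)
        + m * f * (f + 2 * g) * (theta * theta + theta - 1) - q * W"
    by (simp add: W_def algebra_simps power2_eq_square)
  also have "g\<^sup>2 + g * f - (real_of_int f)\<^sup>2 = of_int (g\<^sup>2 + g * f - f\<^sup>2)"
    by simp
  finally show "(m * (f + 2 * g) * theta - (m * (2 * f - g) + q)) * W = m * (1 + 2 * theta) - q * W"
    by (simp add: norm theta_square)
  show "m * (1 + 2 * theta) - q * W = (m - q * f) * (1 + 2 * theta) - q * T"
    by (simp add: W_def T_def algebra_simps)
qed

text \<open>The previous case with \<open>q - theta\<close> for \<open>q\<close>; the new terms come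
  from \<open>theta * W = g * (1 + 2 * theta) - (1 + theta) * T\<close>.\<close>

lemma crossing_1_W:
  fixes m q :: int
  shows "(m * (f + 2 * g) * theta + theta - (m * (2 * f - g) + q)) * W
       = m * (1 + 2 * theta) - (q - theta) * W"
    and "m * (1 + 2 * theta) - (q - theta) * W
       = (m - q * f + g) * (1 + 2 * theta) - (q + 1 + theta) * T"
proof -
  show "(m * (f + 2 * g) * theta + theta - (m * (2 * f - g) + q)) * W
      = m * (1 + 2 * theta) - (q - theta) * W"
    using crossing_0_W(1)[of m q] by (simp add: algebra_simps)
  show "m * (1 + 2 * theta) - (q - theta) * W
      = (m - q * f + g) * (1 + 2 * theta) - (q + 1 + theta) * T"
    by (simp add: W_def T_def algebra_simps theta_square)
qed

lemma crossing_0_lower_bound: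
  fixes m P :: int
  assumes "m \<ge> 1"
    and "0 \<le> m * (f + 2 * g) * theta - P" "m * (f + 2 * g) * theta - P < T * theta"
  shows "m > f * (3 * f + g)"
proof -
  define q where "q = P - m * (2 * f - g)"
  define j where "j = m - q * f"
  define x where "x = m * (f + 2 * g) * theta - P"
  have eq: "x * W = m * (1 + 2 * theta) - q * W"
    using crossing_0_W(1)[of m q] by (simp add: x_def q_def)
  have j: "x * W = j * (1 + 2 * theta) - q * T"
    using eq crossing_0_W(2)[of m q] by (simp add: j_def)
  have lo: "0 \<le> x * W"
    using assms(2) W_pos by (simp add: x_def)
  have hi: "x * W < theta"
    using assms(3) by (simp add: x_def mult_W_less_iff)
  \<comment> \<open>Signs come first: \<open>m \<ge> 1\<close> makes \<open>q\<close> positive,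
    which makes \<open>j\<close> positive, and \<open>j \<ge> 1\<close> then makes \<open>q\<close>
    large.\<close>
  have "1 * (1 + 2 * theta) \<le> m * (1 + 2 * theta)"
    using assms(1) theta_bounds by (intro mult_right_mono) auto
  then have "q * W > 1 + theta"
    using eq hi by (simp add: algebra_simps)
  then have "q * W > 0"
    using theta_bounds by linarith
  then have q: "q \<ge> 1"
    using W_pos by (simp add: zero_less_mult_iff)
  then have "q * T > 0"
    using T_pos by simp
  then have "j * (1 + 2 * theta) > 0"
    using lo j by linarith
  then have j1: "j \<ge> 1"
    using theta_bounds by (simp add: zero_less_mult_iff)
  then have "1 * (1 + 2 * theta) \<le> j * (1 + 2 * theta)"
    using theta_bounds by (intro mult_right_mono) auto
  then have "q * T > 1 + theta"
    using j hi by (simp add: algebra_simps)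
  then have "real_of_int q > 3 * f + g"
    using unit_bound[of q] T_theta_bounds by linarith
  then have "q \<ge> 3 * f + g"
    by linarith
  then have "f * (3 * f + g) \<le> f * q"
    using f_pos by (intro mult_left_mono) auto
  then show ?thesis
    using j1 by (simp add: j_def algebra_simps)
qed

lemma crossing_1_lower_bound:
  fixes m P :: int
  assumes "m \<ge> 1"
    and "0 \<le> m * (f + 2 * g) * theta + theta - P" "m * (f + 2 * g) * theta + theta - P < T * theta"
  shows "m \<ge> 1 + f * (3 * f + g - 1) - g"
proof -
  define q where "q = P - m * (2 * f - g)"
  define j where "j = m - q * f + g"
  define x where "x = m * (f + 2 * g) * theta + theta - P"
  have eq: "x * W = m * (1 + 2 * theta) - (q - theta) * W"
    using crossing_1_W(1)[of m q] by (simp add: x_def q_def)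
  have j: "x * W = j * (1 + 2 * theta) - (q + 1 + theta) * T"
    using eq crossing_1_W(2)[of m q] by (simp add: j_def)
  have lo: "0 \<le> x * W"
    using assms(2) W_pos by (simp add: x_def)
  have hi: "x * W < theta"
    using assms(3) by (simp add: x_def mult_W_less_iff)
  have "1 * (1 + 2 * theta) \<le> m * (1 + 2 * theta)"
    using assms(1) theta_bounds by (intro mult_right_mono) auto
  then have "(q - theta) * W > 1 + theta"
    using eq hi by (simp add: algebra_simps)
  then have "(q - theta) * W > 0"
    using theta_bounds by linarith
  then have "q > theta"
    using W_pos by (simp add: zero_less_mult_iff)
  then have "(q + 1 + theta) * T > 0"
    using T_pos theta_bounds by simp
  then have "j * (1 + 2 * theta) > 0"
    using lo j by linarith
  then have j1: "j \<ge> 1"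
    using theta_bounds by (simp add: zero_less_mult_iff)
  then have "1 * (1 + 2 * theta) \<le> j * (1 + 2 * theta)"
    using theta_bounds by (intro mult_right_mono) auto
  then have "(q + 1 + theta) * T > 1 + theta"
    using j hi by (simp add: algebra_simps)
  \<comment> \<open>The offset \<open>1 + theta < 2\<close> lets \<open>q\<close> be one smaller
    than in the other case.\<close>
  then have "real_of_int q > 3 * f + g - 2"
    using unit_bound[of "q + 1 + theta"] T_theta_bounds theta_bounds by linarith
  then have "q \<ge> 3 * f + g - 1"
    by linarith
  then have "f * (3 * f + g - 1) \<le> f * q"
    using f_pos by (intro mult_left_mono) auto
  then show ?thesis
    using j1 by (simp add: j_def algebra_simps)
qed

lemma crossing_1_attained:
  fixes m :: int
  assumes "m = 1 + f * (3 * f + g - 1) - g"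
  obtains P :: int where "0 \<le> m * (f + 2 * g) * theta + theta - P"
    and "m * (f + 2 * g) * theta + theta - P < T * theta"
proof -
  \<comment> \<open>The least \<open>q\<close> permitted by \<open>crossing_1_lower_bound\<close>;
    with the given \<open>m\<close> it makes \<open>j\<close> equal to 1.\<close>
  define q where "q = 3 * f + g - 1"
  define P where "P = m * (2 * f - g) + q"
  let ?x = "m * (f + 2 * g) * theta + theta - P"
  have "m - q * f + g = 1"
    by (simp add: assms q_def algebra_simps)
  then have "real_of_int m - q * f + g = 1"
    by (metis of_int_1 of_int_add of_int_diff of_int_mult)
  then have x: "?x * W = (1 + 2 * theta) - (q + 1 + theta) * T"
    using crossing_1_W[of m q] by (simp add: P_def)
  have "1 + theta = (3 * f + g + T * theta) * T"
    using T_W unfolding one_plus_theta_W[symmetric] by (simp add: mult.assoc mult.commute)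
  also have "\<dots> < (q + 1 + theta) * T"
    using T_pos T_le theta_bounds
    by (intro mult_strict_right_mono) (auto simp: q_def)
  finally have hi: "?x * W < theta"
    using x by linarith
  \<comment> \<open>Nonnegativity needs \<open>(q + 1 + theta) * T \<le> 1 + 2 * theta\<close>; in
    this form the excess over \<open>1 + theta\<close> is visibly small.\<close>
  have "q + 1 + theta = (1 + theta) * W + theta * (1 - T)"
    unfolding one_plus_theta_W by (simp add: q_def algebra_simps)
  then have "(q + 1 + theta) * T = ((1 + theta) * W + theta * (1 - T)) * T"
    by (rule arg_cong)
  also have "\<dots> = (1 + theta) * (T * W) + theta * ((1 - T) * T)"
    by (simp add: algebra_simps)
  finally have "(q + 1 + theta) * T = 1 + theta + theta * ((1 - T) * T)"
    by (simp add: T_W)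
  moreover have "theta * ((1 - T) * T) \<le> theta * 1"
    using T_pos T_le theta_bounds by (intro mult_left_mono mult_le_one) auto
  ultimately have "0 \<le> ?x * W"
    using x by linarith
  then have "0 \<le> ?x"
    using W_pos by (simp add: zero_le_mult_iff)
  moreover have "?x < T * theta"
    using hi mult_W_less_iff by blast
  ultimately show ?thesis
    using that by blast
qed

end

section \<open>Transfer to the sequence \<open>s\<close>\<close>

theorem theorem12:
  fixes n r a b :: nat
  assumes "n \<ge> 2"
    and "r = lucas (2 * n)"
    and "a = fib (2 * n - 1) - 1"
    and "b = lucas (2 * n) - 1"
  shows "(\<forall>k::nat. k \<le> fib (4 * n + 1) - fib (2 * n + 1) - 2 \<longrightarrow> s (r * k + a) = s (r * k + b)) \<and>
    (\<forall>k::nat. k = fib (4 * n + 1) - fib (2 * n + 1) - 1 \<longrightarrow> s (r * k + a) = 0 \<and> s (r * k + b) = 1)"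
proof -
  obtain l where l: "2 * n = Suc (Suc (2 * l))"
    using assms(1) by (metis Suc_1 Suc_le_D Suc_le_mono mult_Suc_right add_2_eq_Suc)
  define f g :: int where "f = fib (2 * n)" and "g = fib (2 * n - 1)"
  define N :: int where "N = int (fib (4 * n + 1)) - int (fib (2 * n + 1))"
  have fib_pos: "fib (2 * n) \<ge> 1" "fib (2 * n - 1) \<ge> 1"
    using assms(1) fib_neq_0_nat[of "2 * n"] fib_neq_0_nat[of "2 * n - 1"] by linarith+
  interpret golden_pair f g
    using fib_pos fib_odd_even_norm[of l] by unfold_locales (auto simp: f_def g_def l)
  have fib_Suc: "int (fib (2 * n + 1)) = f + g"
    by (simp add: f_def g_def l)
  have r: "int r = f + 2 * g"
    by (simp add: assms(2) f_def g_def l lucas_Suc_eq_fib)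
  have "fib (4 * n + 1) = fib (Suc (2 * n)) * fib (Suc (2 * n)) + fib (2 * n) * fib (2 * n)"
    using fib_add[of "2 * n" "2 * n"] by simp
  then have "int (fib (4 * n + 1)) = (f + g)\<^sup>2 + f\<^sup>2"
    using fib_Suc by (simp add: f_def power2_eq_square)
  then have N: "N = 1 + f * (3 * f + g - 1) - g"
    using norm fib_Suc by (simp add: N_def power2_eq_square algebra_simps)
  have N_ge: "N \<ge> 2" "N = int (fib (4 * n + 1) - fib (2 * n + 1))"
    using fib_diff_ge_2[OF assms(1)] by (simp_all add: N_def)
  define y where "y m = of_int (m * (f + 2 * g)) * theta" for m :: int
  have pos_b: "r * k + b + 1 = r * (k + 1)" for k
    using lucas_ge_1[of "2 * n"] by (simp add: assms)
  have pos_a: "int (r * k + a + 1) = int r * (int k + 1) - (f + g)" for k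
    using fib_pos r by (simp add: assms(3) g_def algebra_simps)
  have s_eq: "s i = \<lfloor>of_int (int (i + 1)) * theta + theta\<rfloor> - \<lfloor>of_int (int (i + 1)) * theta\<rfloor>" for i
    by (simp add: s_def algebra_simps)
  have sb: "s (r * k + b) = \<lfloor>y (int k + 1) + theta\<rfloor> - \<lfloor>y (int k + 1)\<rfloor>" for k
  proof -
    have "of_int (int (r * k + b + 1)) * theta = y (int k + 1)"
      unfolding pos_b y_def r[symmetric] by (simp add: algebra_simps)
    then show ?thesis
      by (simp only: s_eq)
  qed
  \<comment> \<open>The integer \<open>f\<close> cancels in the difference of floors, leaving only
    the shift by \<open>T * theta\<close>.\<close>
  have shift: "of_int (int r * (int k + 1) - (f + g)) * theta = y (int k + 1) - T * theta - f" for k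
    unfolding r y_def T_theta by (simp add: algebra_simps)
  have sa: "s (r * k + a) = \<lfloor>y (int k + 1) + theta - T * theta\<rfloor> - \<lfloor>y (int k + 1) - T * theta\<rfloor>" for k
  proof -
    have "s (r * k + a) = \<lfloor>y (int k + 1) + theta - T * theta - of_int f\<rfloor>
        - \<lfloor>y (int k + 1) - T * theta - of_int f\<rfloor>"
      unfolding s_eq pos_a shift by (simp add: algebra_simps)
    then show ?thesis
      by (simp only: floor_diff_of_int)
  qed
  have T1: "0 \<le> T * theta" "T * theta < 1"
    using T_theta_bounds theta_bounds by linarith+
  have "s (r * k + a) = s (r * k + b)" if "k \<le> fib (4 * n + 1) - fib (2 * n + 1) - 2" for k
  proof -
    define m where "m = int k + 1"
    have m: "m \<ge> 1" "m < N"
      using that N_ge by (simp_all add: m_def)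
    \<comment> \<open>Hence the first kind of crossing cannot occur for
      \<open>m < N\<close>.\<close>
    have "N \<le> f * (3 * f + g)"
      using f_pos g_pos by (simp add: N algebra_simps)
    then have "T * theta \<le> y m - of_int \<lfloor>y m\<rfloor>"
      using crossing_0_lower_bound[of m "\<lfloor>y m\<rfloor>"] m by (force simp: y_def)
    moreover have "T * theta \<le> y m + theta - of_int \<lfloor>y m + theta\<rfloor>"
      using crossing_1_lower_bound[of m "\<lfloor>y m + theta\<rfloor>"] m N by (force simp: y_def)
    ultimately show ?thesis
      unfolding sa sb m_def[symmetric] floor_diff_eq_iff[OF T1, symmetric] by simp
  qed
  moreover have "s (r * k + a) = 0 \<and> s (r * k + b) = 1"
    if "k = fib (4 * n + 1) - fib (2 * n + 1) - 1" for k
  proof -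
    have k: "int k + 1 = N"
      using that N_ge by simp
    obtain P where P: "0 \<le> y N + theta - of_int P" "y N + theta - of_int P < T * theta"
      using crossing_1_attained[OF N] by (auto simp: y_def)
    \<comment> \<open>Only \<open>y N + theta\<close> reaches \<open>P\<close>;
      \<open>T * theta < 1 - theta\<close> keeps even \<open>y N - T * theta\<close> above
      \<open>P - 1\<close>.\<close>
    have "\<lfloor>y N + theta\<rfloor> = P" "\<lfloor>y N\<rfloor> = P - 1"
      "\<lfloor>y N + theta - T * theta\<rfloor> = P - 1" "\<lfloor>y N - T * theta\<rfloor> = P - 1"
      using P T_theta_bounds theta_bounds by (simp_all add: floor_eq_iff)
    then show ?thesis
      unfolding sa sb k by simp
  qed
  ultimately show ?thesis
    by blast
qed

end
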